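(* Let $\{T_m\}_{m\in M}$ be an extensible $M$-graded monad on $\mathbf{Set}$, $L$ a set of labels containing $\tau$, $m\perp n$ in $M$, and $\alpha_{X,Y}:T_mX\times T_nY\to T_{m+n}(X\times Y)$ a natural transformation. Then there is a functor $\parallel:\mathrm{Coalg}(\mathcal{P}(T_m-)^L)\times\mathrm{Coalg}(\mathcal{P}(T_n-)^L)\to\mathrm{Coalg}(\mathcal{P}(T_{m+n}-)^L)$ defined on objects by $(X,c)\parallel(Y,d)=(X\times Y,\ \mathcal{P}(\alpha_{X,Y})^L\circ(c\,|\,d))$ and on morphisms by $f\parallel g=f\times g$.
   Context: $\mathcal{P}$ is the finite powerset functor and $\mathcal{P}(F-)^L$ denotes the functor $X\mapsto\mathcal{P}(FX)^L$ (functions from $L$ to finite subsets of $FX$), acting on maps by labelwise direct image; $\mathcal{P}(\alpha)^L$ applies $\alpha$ elementwise labelwise. $\mathrm{Coalg}(G)$ is the category of $G$-coalgebras $(X,c:X\to GX)$ with homomorphisms $f$ satisfying $Gf\circ c=d\circ f$. Write $s\xrightarrow{\mu}\Delta$ for $\Delta\in c(s)(\mu)$; labels other than $\tau$ carry an involution $\mu\mapsto\overline{\mu}$. A partial commutative monoid $\langle M,0,+\rangle$ has a partial commutative associative operation with unit $0$ ($m\perp n$ means $m+n$ is defined); $a\preceq b$ iff $a+c=b$ for some $c$. An $M$-graded monad on $\mathbf{Set}$: endofunctors $T_m$, natural $\eta:\mathrm{Id}\to T_0$, natural $\mu_{m,n}:T_mT_n\to T_{m+n}$ for $m\perp n$,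 associative and unital. Extensible: natural $\xi_{m\preceq n}:T_m\to T_n$ for $m\preceq n$, with $\xi_{m\preceq m}=\mathrm{Id}$, $\xi_{n\preceq o}\circ\xi_{m\preceq n}=\xi_{m\preceq o}$. CCS-style synchronization $c\,|\,d:X\times Y\to\mathcal{P}(T_mX\times T_nY)^L$ of $c:X\to\mathcal{P}(T_mX)^L$ and $d:Y\to\mathcal{P}(T_nY)^L$: the least transition function with: if $s\xrightarrow{\mu}\Delta$ then $(s,t)\xrightarrow{\mu}\langle\Delta,\xi_{0\preceq n}(\eta(t))\rangle$; if $t\xrightarrow{\mu}\Theta$ then $(s,t)\xrightarrow{\mu}\langle\xi_{0\preceq m}(\eta(s)),\Theta\rangle$; if $s\xrightarrow{\mu}\Delta$ and $t\xrightarrow{\overline{\mu}}\Theta$ then $(s,t)\xrightarrow{\tau}\langle\Delta,\Theta\rangle$.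
   Formalization: It is assumed that c|d really maps into finite subsets, X×Y→P(T_mX×T_nY)^L, for all coalgebras c, d. This always holds for finite L; for infinite L a state of c|d can have infinitely many τ-successors, so the claim as printed can fail. *)

theory Defs
  imports "HOL-Library.FuncSet"
begin

section \<open>Categories, functors, natural transformations\<close>

text \<open>
  Hom-sets are not required to be disjoint, so composition and the arrow part of a functor
  take the objects involved as arguments: \<open>Cmp C X Y Z g f\<close> is the composite of
  \<open>f : X \<rightarrow> Y\<close> and \<open>g : Y \<rightarrow> Z\<close>.
\<close>

record ('o, 'a) cat =
  Obj :: "'o set"
  Hom :: "'o \<Rightarrow> 'o \<Rightarrow> 'a set"
  Idn :: "'o \<Rightarrow> 'a"
  Cmp :: "'o \<Rightarrow> 'o \<Rightarrow> 'o \<Rightarrow> 'a \<Rightarrow> 'a \<Rightarrow> 'a"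

definition is_category :: "('o, 'a) cat \<Rightarrow> bool" where
  "is_category C \<longleftrightarrow>
     (\<forall>X\<in>Obj C. Idn C X \<in> Hom C X X) \<and>
     (\<forall>X\<in>Obj C. \<forall>Y\<in>Obj C. \<forall>Z\<in>Obj C. \<forall>f\<in>Hom C X Y. \<forall>g\<in>Hom C Y Z.
        Cmp C X Y Z g f \<in> Hom C X Z) \<and>
     (\<forall>X\<in>Obj C. \<forall>Y\<in>Obj C. \<forall>f\<in>Hom C X Y.
        Cmp C X X Y f (Idn C X) = f \<and> Cmp C X Y Y (Idn C Y) f = f) \<and>
     (\<forall>W\<in>Obj C. \<forall>X\<in>Obj C. \<forall>Y\<in>Obj C. \<forall>Z\<in>Obj C.
        \<forall>f\<in>Hom C W X. \<forall>g\<in>Hom C X Y. \<forall>h\<in>Hom C Y Z.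
        Cmp C W X Z (Cmp C X Y Z h g) f = Cmp C W Y Z h (Cmp C W X Y g f))"

record ('o, 'a, 'p, 'b) ftor =
  FObj :: "'o \<Rightarrow> 'p"
  FArr :: "'o \<Rightarrow> 'o \<Rightarrow> 'a \<Rightarrow> 'b"

definition is_functor ::
  "('o, 'a) cat \<Rightarrow> ('p, 'b) cat \<Rightarrow> ('o, 'a, 'p, 'b) ftor \<Rightarrow> bool" where
  "is_functor C D F \<longleftrightarrow>
     is_category C \<and> is_category D \<and>
     (\<forall>X\<in>Obj C. FObj F X \<in> Obj D) \<and>
     (\<forall>X\<in>Obj C. \<forall>Y\<in>Obj C. \<forall>f\<in>Hom C X Y.
        FArr F X Y f \<in> Hom D (FObj F X) (FObj F Y)) \<and>
     (\<forall>X\<in>Obj C. FArr F X X (Idn C X) = Idn D (FObj F X)) \<and>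
     (\<forall>X\<in>Obj C. \<forall>Y\<in>Obj C. \<forall>Z\<in>Obj C. \<forall>f\<in>Hom C X Y. \<forall>g\<in>Hom C Y Z.
        FArr F X Z (Cmp C X Y Z g f) =
        Cmp D (FObj F X) (FObj F Y) (FObj F Z) (FArr F Y Z g) (FArr F X Y f))"

definition is_nat_trans ::
  "('o, 'a) cat \<Rightarrow> ('p, 'b) cat \<Rightarrow> ('o, 'a, 'p, 'b) ftor \<Rightarrow> ('o, 'a, 'p, 'b) ftor
    \<Rightarrow> ('o \<Rightarrow> 'b) \<Rightarrow> bool" where
  "is_nat_trans C D F G \<phi> \<longleftrightarrow>
     (\<forall>X\<in>Obj C. \<phi> X \<in> Hom D (FObj F X) (FObj G X)) \<and>
     (\<forall>X\<in>Obj C. \<forall>Y\<in>Obj C. \<forall>f\<in>Hom C X Y.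
        Cmp D (FObj F X) (FObj G X) (FObj G Y) (FArr G X Y f) (\<phi> X) =
        Cmp D (FObj F X) (FObj F Y) (FObj G Y) (\<phi> Y) (FArr F X Y f))"

definition id_functor :: "('o, 'a, 'o, 'a) ftor" where
  "id_functor = \<lparr>FObj = (\<lambda>X. X), FArr = (\<lambda>X Y f. f)\<rparr>"

definition comp_functor ::
  "('p, 'b, 'q, 'c) ftor \<Rightarrow> ('o, 'a, 'p, 'b) ftor \<Rightarrow> ('o, 'a, 'q, 'c) ftor" where
  "comp_functor G F =
     \<lparr>FObj = (\<lambda>X. FObj G (FObj F X)),
      FArr = (\<lambda>X Y f. FArr G (FObj F X) (FObj F Y) (FArr F X Y f))\<rparr>"

definition prod_cat :: "('o, 'a) cat \<Rightarrow> ('p, 'b) cat \<Rightarrow> ('o \<times> 'p, 'a \<times> 'b) cat" where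
  "prod_cat C D =
     \<lparr>Obj = Obj C \<times> Obj D,
      Hom = (\<lambda>(X, X') (Y, Y'). Hom C X Y \<times> Hom D X' Y'),
      Idn = (\<lambda>(X, X'). (Idn C X, Idn D X')),
      Cmp = (\<lambda>(X, X') (Y, Y') (Z, Z') (g, g') (f, f').
               (Cmp C X Y Z g f, Cmp D X' Y' Z' g' f'))\<rparr>"

definition prod_functor ::
  "('o, 'a, 'p, 'b) ftor \<Rightarrow> ('q, 'c, 'r, 'd) ftor \<Rightarrow> ('o \<times> 'q, 'a \<times> 'c, 'p \<times> 'r, 'b \<times> 'd) ftor"
  where
  "prod_functor F G =
     \<lparr>FObj = (\<lambda>(X, Y). (FObj F X, FObj G Y)),
      FArr = (\<lambda>(X, Y) (X', Y') (f, g). (FArr F X X' f, FArr G Y Y' g))\<rparr>"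


section \<open>The category of sets\<close>

text \<open>
  HOL has no type of all sets, and the functors below have to be quantified over. So
  \<^emph>\<open>Set\<close> is represented by a family of subsets of a type of elements, with all maps
  between them, closed under cartesian products with respect to an injective pairing of
  elements. No further closure is needed, so this covers the powerset of any infinite type as
  well as the sets of any model of set theory available as a type.
  A map \<open>X \<rightarrow> Y\<close> is an element of \<open>X \<rightarrow>\<^sub>E Y\<close> (it is \<open>undefined\<close> outside
  \<open>X\<close>), so that equality of maps is equality on \<open>X\<close>.
\<close>

record 'u universe =
  Sets :: "'u set set"
  pair :: "'u \<times> 'u \<Rightarrow> 'u"

definition prod_set :: "'u universe \<Rightarrow> 'u set \<Rightarrow> 'u set \<Rightarrow> 'u set" where
  "prod_set V X Y = pair V ` (X \<times> Y)"

definition is_universe :: "'u universe \<Rightarrow> bool" where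
  "is_universe V \<longleftrightarrow> inj (pair V) \<and> (\<forall>X\<in>Sets V. \<forall>Y\<in>Sets V. prod_set V X Y \<in> Sets V)"

definition prod_map ::
  "'u universe \<Rightarrow> 'u set \<Rightarrow> 'u set \<Rightarrow> ('u \<Rightarrow> 'u) \<Rightarrow> ('u \<Rightarrow> 'u) \<Rightarrow> 'u \<Rightarrow> 'u" where
  "prod_map V X Y f g = (\<lambda>p\<in>prod_set V X Y. pair V (map_prod f g (inv (pair V) p)))"

definition cat_of_sets :: "'v set set \<Rightarrow> ('v set, 'v \<Rightarrow> 'v) cat" where
  "cat_of_sets \<U> =
     \<lparr>Obj = \<U>,
      Hom = (\<lambda>X Y. X \<rightarrow>\<^sub>E Y),
      Idn = (\<lambda>X. \<lambda>x\<in>X. x),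
      Cmp = (\<lambda>X Y Z g f. compose X g f)\<rparr>"

abbreviation Set_cat :: "'u universe \<Rightarrow> ('u set, 'u \<Rightarrow> 'u) cat" where
  "Set_cat V \<equiv> cat_of_sets (Sets V)"

definition times_functor ::
  "'u universe \<Rightarrow> ('u set \<times> 'u set, ('u \<Rightarrow> 'u) \<times> ('u \<Rightarrow> 'u), 'u set, 'u \<Rightarrow> 'u) ftor" where
  "times_functor V =
     \<lparr>FObj = (\<lambda>(X, Y). prod_set V X Y),
      FArr = (\<lambda>(X, Y) (X', Y') (f, g). prod_map V X Y f g)\<rparr>"


section \<open>Labelled finite powersets and coalgebras\<close>

text \<open>
  The set of labels \<open>L\<close> is the type \<open>'l\<close>. The values of the functor
  \<open>\<P>(-)\<^sup>L\<close> are sets of elements of type \<open>'l \<Rightarrow> 'u set\<close>; they need not be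
  encoded in \<open>Sets V\<close> for coalgebras \<open>X \<rightarrow> G X\<close> to make sense.
\<close>

definition pow_set :: "'u set \<Rightarrow> ('l \<Rightarrow> 'u set) set" where
  "pow_set X = {\<phi>. \<forall>\<mu>. finite (\<phi> \<mu>) \<and> \<phi> \<mu> \<subseteq> X}"

definition pow_map :: "'u set \<Rightarrow> ('u \<Rightarrow> 'u) \<Rightarrow> ('l \<Rightarrow> 'u set) \<Rightarrow> ('l \<Rightarrow> 'u set)" where
  "pow_map X f = (\<lambda>\<phi>\<in>pow_set X. \<lambda>\<mu>. f ` \<phi> \<mu>)"

definition pow_functor ::
  "('u set, 'u \<Rightarrow> 'u, ('l \<Rightarrow> 'u set) set, ('l \<Rightarrow> 'u set) \<Rightarrow> ('l \<Rightarrow> 'u set)) ftor" where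
  "pow_functor = \<lparr>FObj = pow_set, FArr = (\<lambda>X Y f. pow_map X f)\<rparr>"

definition Coalg ::
  "'u universe \<Rightarrow> ('u set, 'u \<Rightarrow> 'u, 'v set, 'v \<Rightarrow> 'v) ftor
    \<Rightarrow> ('u set \<times> ('u \<Rightarrow> 'v), 'u \<Rightarrow> 'u) cat" where
  "Coalg V G =
     \<lparr>Obj = {(X, c). X \<in> Sets V \<and> c \<in> X \<rightarrow>\<^sub>E FObj G X},
      Hom = (\<lambda>(X, c) (Y, d).
               {f \<in> X \<rightarrow>\<^sub>E Y. compose X (FArr G X Y f) c = compose X d f}),
      Idn = (\<lambda>(X, c). \<lambda>x\<in>X. x),
      Cmp = (\<lambda>(X, c) (Y, d) (Z, e) g f. compose X g f)\<rparr>"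


section \<open>Partial commutative monoids and graded monads\<close>

text \<open>\<open>padd P m n = None\<close> encodes that the sum is undefined.\<close>

record 'm pcm =
  pzero :: 'm
  padd :: "'m \<Rightarrow> 'm \<Rightarrow> 'm option"

definition is_pcm :: "'m pcm \<Rightarrow> bool" where
  "is_pcm P \<longleftrightarrow>
     (\<forall>a. padd P (pzero P) a = Some a) \<and>
     (\<forall>a b. padd P a b = padd P b a) \<and>
     (\<forall>a b c. Option.bind (padd P a b) (\<lambda>x. padd P x c) =
              Option.bind (padd P b c) (\<lambda>y. padd P a y))"

definition orth :: "'m pcm \<Rightarrow> 'm \<Rightarrow> 'm \<Rightarrow> bool" where
  "orth P m n \<longleftrightarrow> padd P m n \<noteq> None"

definition psum :: "'m pcm \<Rightarrow> 'm \<Rightarrow> 'm \<Rightarrow> 'm" where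
  "psum P m n = the (padd P m n)"

definition prec :: "'m pcm \<Rightarrow> 'm \<Rightarrow> 'm \<Rightarrow> bool" where
  "prec P a b \<longleftrightarrow> (\<exists>c. padd P a c = Some b)"

text \<open>
  \<open>gmult T m n\<close> is only constrained when \<open>m\<close> and \<open>n\<close> are orthogonal, and
  \<open>gext T m n\<close> only when \<open>m\<close> precedes \<open>n\<close>.
\<close>

record ('m, 'u) graded =
  gfun :: "'m \<Rightarrow> ('u set, 'u \<Rightarrow> 'u, 'u set, 'u \<Rightarrow> 'u) ftor"
  gunit :: "'u set \<Rightarrow> 'u \<Rightarrow> 'u"
  gmult :: "'m \<Rightarrow> 'm \<Rightarrow> 'u set \<Rightarrow> 'u \<Rightarrow> 'u"
  gext :: "'m \<Rightarrow> 'm \<Rightarrow> 'u set \<Rightarrow> 'u \<Rightarrow> 'u"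

definition is_graded_monad :: "'u universe \<Rightarrow> 'm pcm \<Rightarrow> ('m, 'u) graded \<Rightarrow> bool" where
  "is_graded_monad V P T \<longleftrightarrow>
     (\<forall>m. is_functor (Set_cat V) (Set_cat V) (gfun T m)) \<and>
     is_nat_trans (Set_cat V) (Set_cat V) id_functor (gfun T (pzero P)) (gunit T) \<and>
     (\<forall>m n. orth P m n \<longrightarrow>
        is_nat_trans (Set_cat V) (Set_cat V)
          (comp_functor (gfun T m) (gfun T n)) (gfun T (psum P m n)) (gmult T m n)) \<and>
     (\<forall>m n k. orth P m n \<longrightarrow> orth P (psum P m n) k \<longrightarrow>
        (\<forall>X\<in>Sets V. \<forall>x\<in>FObj (gfun T m) (FObj (gfun T n) (FObj (gfun T k) X)).
           gmult T (psum P m n) k X (gmult T m n (FObj (gfun T k) X) x) =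
           gmult T m (psum P n k) X
             (FArr (gfun T m) (FObj (gfun T n) (FObj (gfun T k) X))
                (FObj (gfun T (psum P n k)) X) (gmult T n k X) x))) \<and>
     (\<forall>m. \<forall>X\<in>Sets V. \<forall>x\<in>FObj (gfun T m) X.
        gmult T (pzero P) m X (gunit T (FObj (gfun T m) X) x) = x \<and>
        gmult T m (pzero P) X
          (FArr (gfun T m) X (FObj (gfun T (pzero P)) X) (gunit T X) x) = x)"

definition is_extensible :: "'u universe \<Rightarrow> 'm pcm \<Rightarrow> ('m, 'u) graded \<Rightarrow> bool" where
  "is_extensible V P T \<longleftrightarrow>
     (\<forall>m n. prec P m n \<longrightarrow>
        is_nat_trans (Set_cat V) (Set_cat V) (gfun T m) (gfun T n) (gext T m n)) \<and>
     (\<forall>m. \<forall>X\<in>Sets V. \<forall>x\<in>FObj (gfun T m) X. gext T m m X x = x) \<and>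
     (\<forall>m n k. prec P m n \<longrightarrow> prec P n k \<longrightarrow>
        (\<forall>X\<in>Sets V. \<forall>x\<in>FObj (gfun T m) X.
           gext T n k X (gext T m n X x) = gext T m k X x))"


section \<open>CCS-style synchronization\<close>

record 'l labels =
  tau :: 'l
  bar :: "'l \<Rightarrow> 'l"

definition is_labels :: "'l labels \<Rightarrow> bool" where
  "is_labels A \<longleftrightarrow> (\<forall>\<mu>. \<mu> \<noteq> tau A \<longrightarrow> bar A \<mu> \<noteq> tau A \<and> bar A (bar A \<mu>) = \<mu>)"

inductive sync_step ::
  "'u universe \<Rightarrow> 'm pcm \<Rightarrow> ('m, 'u) graded \<Rightarrow> 'l labels \<Rightarrow> 'm \<Rightarrow> 'm
    \<Rightarrow> 'u set \<times> ('u \<Rightarrow> 'l \<Rightarrow> 'u set) \<Rightarrow> 'u set \<times> ('u \<Rightarrow> 'l \<Rightarrow> 'u set)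
    \<Rightarrow> 'u \<Rightarrow> 'l \<Rightarrow> 'u \<Rightarrow> bool"
  for V :: "'u universe" and P :: "'m pcm" and T :: "('m, 'u) graded" and A :: "'l labels"
  and m n :: 'm and Xc Yd :: "'u set \<times> ('u \<Rightarrow> 'l \<Rightarrow> 'u set)" where
  left: "s \<in> fst Xc \<Longrightarrow> t \<in> fst Yd \<Longrightarrow> \<Delta> \<in> snd Xc s \<mu> \<Longrightarrow>
    sync_step V P T A m n Xc Yd (pair V (s, t)) \<mu>
      (pair V (\<Delta>, gext T (pzero P) n (fst Yd) (gunit T (fst Yd) t)))"
| right: "s \<in> fst Xc \<Longrightarrow> t \<in> fst Yd \<Longrightarrow> \<Theta> \<in> snd Yd t \<mu> \<Longrightarrow>
    sync_step V P T A m n Xc Yd (pair V (s, t)) \<mu>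
      (pair V (gext T (pzero P) m (fst Xc) (gunit T (fst Xc) s), \<Theta>))"
| comm: "s \<in> fst Xc \<Longrightarrow> t \<in> fst Yd \<Longrightarrow> \<mu> \<noteq> tau A \<Longrightarrow>
    \<Delta> \<in> snd Xc s \<mu> \<Longrightarrow> \<Theta> \<in> snd Yd t (bar A \<mu>) \<Longrightarrow>
    sync_step V P T A m n Xc Yd (pair V (s, t)) (tau A) (pair V (\<Delta>, \<Theta>))"

definition sync ::
  "'u universe \<Rightarrow> 'm pcm \<Rightarrow> ('m, 'u) graded \<Rightarrow> 'l labels \<Rightarrow> 'm \<Rightarrow> 'm
    \<Rightarrow> 'u set \<times> ('u \<Rightarrow> 'l \<Rightarrow> 'u set) \<Rightarrow> 'u set \<times> ('u \<Rightarrow> 'l \<Rightarrow> 'u set)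
    \<Rightarrow> 'u \<Rightarrow> 'l \<Rightarrow> 'u set" where
  "sync V P T A m n Xc Yd =
     (\<lambda>p\<in>prod_set V (fst Xc) (fst Yd). \<lambda>\<mu>. {q. sync_step V P T A m n Xc Yd p \<mu> q})"

abbreviation Coalg_pow ::
  "'u universe \<Rightarrow> ('u set, 'u \<Rightarrow> 'u, 'u set, 'u \<Rightarrow> 'u) ftor
    \<Rightarrow> ('u set \<times> ('u \<Rightarrow> 'l \<Rightarrow> 'u set), 'u \<Rightarrow> 'u) cat" where
  "Coalg_pow V F \<equiv> Coalg V (comp_functor pow_functor F)"

text \<open>
  Synchronization is presupposed to be an operation
  \<open>X \<times> Y \<rightarrow> \<P>(T\<^sub>m X \<times> T\<^sub>n Y)\<^sup>L\<close>. Only finiteness of the set of \<open>tau\<close>-successors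
  is at stake: it is a union over all labels, so it can be infinite when there are infinitely
  many labels. For finitely many labels the presupposition always holds
  (lemma \<open>sync_well_defined_finite\<close>).
\<close>

definition sync_well_defined ::
  "'u universe \<Rightarrow> 'm pcm \<Rightarrow> ('m, 'u) graded \<Rightarrow> 'l labels \<Rightarrow> 'm \<Rightarrow> 'm \<Rightarrow> bool" where
  "sync_well_defined V P T A m n \<longleftrightarrow>
     (\<forall>(X, c)\<in>Obj (Coalg_pow V (gfun T m)). \<forall>(Y, d)\<in>Obj (Coalg_pow V (gfun T n)).
        sync V P T A m n (X, c) (Y, d) \<in>
          prod_set V X Y \<rightarrow>\<^sub>E
            (pow_set (prod_set V (FObj (gfun T m) X) (FObj (gfun T n) Y)) :: ('l \<Rightarrow> 'u set) set))"

lemma sync_well_defined_finite: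
  fixes A :: "'l labels"
  assumes fin: "finite (UNIV :: 'l set)"
    and V: "is_universe V" and P: "is_pcm P"
    and T: "is_graded_monad V P T" and E: "is_extensible V P T"
  shows "sync_well_defined V P T A m n"
proof -
  have emb: "gext T (pzero P) k Z (gunit T Z z) \<in> FObj (gfun T k) Z"
    if "Z \<in> Sets V" "z \<in> Z" for k Z z
  proof -
    have "prec P (pzero P) k" using P by (auto simp: prec_def is_pcm_def)
    then have "gext T (pzero P) k Z \<in> FObj (gfun T (pzero P)) Z \<rightarrow> FObj (gfun T k) Z"
      using E that(1) unfolding is_extensible_def is_nat_trans_def cat_of_sets_def
      by (simp add: PiE_def)
    moreover have "gunit T Z \<in> Z \<rightarrow> FObj (gfun T (pzero P)) Z"
      using T that(1) unfolding is_graded_monad_def is_nat_trans_def cat_of_sets_def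
      by (simp add: PiE_def id_functor_def)
    ultimately show ?thesis using that by blast
  qed
  have "sync V P T A m n (X, c) (Y, d) \<in>
          prod_set V X Y \<rightarrow>\<^sub>E pow_set (prod_set V (FObj (gfun T m) X) (FObj (gfun T n) Y))"
    if X: "X \<in> Sets V" and Y: "Y \<in> Sets V"
      and c: "c \<in> X \<rightarrow>\<^sub>E pow_set (FObj (gfun T m) X)" and d: "d \<in> Y \<rightarrow>\<^sub>E pow_set (FObj (gfun T n) Y)"
    for X Y c d
  proof -
    have main: "finite {q. sync_step V P T A m n (X, c) (Y, d) (pair V (s, t)) \<mu> q} \<and>
        {q. sync_step V P T A m n (X, c) (Y, d) (pair V (s, t)) \<mu> q}
          \<subseteq> prod_set V (FObj (gfun T m) X) (FObj (gfun T n) Y)"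
      if s: "s \<in> X" and t: "t \<in> Y" for s t \<mu>
    proof -
      have cs: "finite (c s \<nu>)" "c s \<nu> \<subseteq> FObj (gfun T m) X" for \<nu>
        using PiE_mem[OF c s] by (simp_all add: pow_set_def)
      have dt: "finite (d t \<nu>)" "d t \<nu> \<subseteq> FObj (gfun T n) Y" for \<nu>
        using PiE_mem[OF d t] by (simp_all add: pow_set_def)
      define C where "C = insert (gext T (pzero P) m X (gunit T X s)) (\<Union>\<nu>. c s \<nu>)"
      define D where "D = insert (gext T (pzero P) n Y (gunit T Y t)) (\<Union>\<nu>. d t \<nu>)"
      have CD: "finite C" "finite D" using cs dt fin by (auto simp: C_def D_def)
      have C: "C \<subseteq> FObj (gfun T m) X"
        unfolding C_def using cs(2) emb[OF X s] by blast
      have D: "D \<subseteq> FObj (gfun T n) Y"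
        unfolding D_def using dt(2) emb[OF Y t] by blast
      have inj: "pair V (a, b) = pair V (a', b') \<longleftrightarrow> a = a' \<and> b = b'" for a b a' b'
        using V inj_eq[of "pair V"] by (simp add: is_universe_def)
      have sub: "{q. sync_step V P T A m n (X, c) (Y, d) (pair V (s, t)) \<mu> q} \<subseteq> prod_set V C D"
      proof (rule subsetI, drule CollectD)
        fix q assume "sync_step V P T A m n (X, c) (Y, d) (pair V (s, t)) \<mu> q"
        then show "q \<in> prod_set V C D"
        proof cases
          case (left s' t' \<Delta>)
          then have "\<Delta> \<in> C" by (auto simp: inj C_def)
          with left show ?thesis by (simp add: inj D_def prod_set_def)
        next
          case (right s' t' \<Theta>)
          then have "\<Theta> \<in> D" by (auto simp: inj D_def)
          with right show ?thesis by (simp add: inj C_def prod_set_def)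
        next
          case (comm s' t' \<nu> \<Delta> \<Theta>)
          then have "\<Delta> \<in> C" "\<Theta> \<in> D" by (auto simp: inj C_def D_def)
          with comm show ?thesis by (simp add: prod_set_def)
        qed
      qed
      have "finite (prod_set V C D)" using CD by (simp add: prod_set_def)
      moreover have "prod_set V C D \<subseteq> prod_set V (FObj (gfun T m) X) (FObj (gfun T n) Y)"
        using C D by (auto simp: prod_set_def)
      ultimately show ?thesis using sub by (meson finite_subset subset_trans)
    qed
    show ?thesis
    proof (rule PiE_I)
      fix p assume p: "p \<in> prod_set V X Y"
      then obtain s t where st: "p = pair V (s, t)" "s \<in> X" "t \<in> Y"
        by (auto simp: prod_set_def)
      show "sync V P T A m n (X, c) (Y, d) p
          \<in> pow_set (prod_set V (FObj (gfun T m) X) (FObj (gfun T n) Y))"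
        using main[OF st(2,3)] p st(1) by (simp add: sync_def pow_set_def)
    qed (simp add: sync_def)
  qed
  then show ?thesis
    by (simp add: sync_well_defined_def Coalg_def comp_functor_def pow_functor_def)
qed

end

theory Submission
  imports Defs
begin

text \<open>
  The morphism part rests on a labelwise identity: along coalgebra homomorphisms \<open>f\<close> and \<open>g\<close>,
  the synchronized successors of \<open>(f s, g t)\<close> are the images under \<open>T\<^sub>m f \<times> T\<^sub>n g\<close> of the
  successors of \<open>(s, t)\<close>. For the two interleaving rules this is naturality of the injection
  \<open>\<xi> \<circ> \<eta>\<close>, and for communication it is the homomorphism property of \<open>f\<close> and \<open>g\<close>.
  Naturality of \<open>\<alpha>\<close> carries the identity over to \<open>T\<^bsub>m+n\<^esub> (f \<times> g)\<close>.
\<close>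

section \<open>Functors, product categories and composite functors\<close>

lemma is_functorI:
  assumes "is_category C" "is_category D"
    and "\<And>X. X \<in> Obj C \<Longrightarrow> FObj F X \<in> Obj D"
    and "\<And>X Y f. X \<in> Obj C \<Longrightarrow> Y \<in> Obj C \<Longrightarrow> f \<in> Hom C X Y \<Longrightarrow>
           FArr F X Y f \<in> Hom D (FObj F X) (FObj F Y)"
    and "\<And>X. X \<in> Obj C \<Longrightarrow> FArr F X X (Idn C X) = Idn D (FObj F X)"
    and "\<And>X Y Z f g. X \<in> Obj C \<Longrightarrow> Y \<in> Obj C \<Longrightarrow> Z \<in> Obj C \<Longrightarrow>
           f \<in> Hom C X Y \<Longrightarrow> g \<in> Hom C Y Z \<Longrightarrow>
           FArr F X Z (Cmp C X Y Z g f) =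
           Cmp D (FObj F X) (FObj F Y) (FObj F Z) (FArr F Y Z g) (FArr F X Y f)"
  shows "is_functor C D F"
  using assms by (simp add: is_functor_def)

lemma is_functorD:
  assumes "is_functor C D F"
  shows is_functor_cat: "is_category C" "is_category D"
    and is_functor_obj: "X \<in> Obj C \<Longrightarrow> FObj F X \<in> Obj D"
    and is_functor_arr: "X \<in> Obj C \<Longrightarrow> Y \<in> Obj C \<Longrightarrow> f \<in> Hom C X Y \<Longrightarrow>
           FArr F X Y f \<in> Hom D (FObj F X) (FObj F Y)"
    and is_functor_id: "X \<in> Obj C \<Longrightarrow> FArr F X X (Idn C X) = Idn D (FObj F X)"
    and is_functor_comp: "X \<in> Obj C \<Longrightarrow> Y \<in> Obj C \<Longrightarrow> Z \<in> Obj C \<Longrightarrow>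
           f \<in> Hom C X Y \<Longrightarrow> g \<in> Hom C Y Z \<Longrightarrow>
           FArr F X Z (Cmp C X Y Z g f) =
           Cmp D (FObj F X) (FObj F Y) (FObj F Z) (FArr F Y Z g) (FArr F X Y f)"
  using assms by (simp_all add: is_functor_def)

lemma is_category_prod_cat:
  assumes "is_category C" "is_category D"
  shows "is_category (prod_cat C D)"
  using assms unfolding is_category_def prod_cat_def by (auto simp: split_beta)

lemma is_functor_comp_functor:
  assumes F: "is_functor B C F" and G: "is_functor C D G"
  shows "is_functor B D (comp_functor G F)"
  by (rule is_functorI)
    (simp_all add: comp_functor_def is_functorD[OF F] is_functorD[OF G])

section \<open>The category of sets with extensional maps\<close>

lemma cat_of_sets_simps [simp]:
  "Obj (cat_of_sets \<U>) = \<U>"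
  "Hom (cat_of_sets \<U>) X Y = X \<rightarrow>\<^sub>E Y"
  "Idn (cat_of_sets \<U>) X = (\<lambda>x\<in>X. x)"
  "Cmp (cat_of_sets \<U>) X Y Z g f = compose X g f"
  by (simp_all add: cat_of_sets_def)

lemma compose_in_PiE: "f \<in> X \<rightarrow>\<^sub>E Y \<Longrightarrow> g \<in> Y \<rightarrow>\<^sub>E Z \<Longrightarrow> compose X g f \<in> X \<rightarrow>\<^sub>E Z"
  by (auto simp: compose_def)

lemma is_category_cat_of_sets: "is_category (cat_of_sets \<U>)"
  unfolding is_category_def
proof (intro conjI ballI)
  \<comment> \<open>The unit laws are equations of total functions, so they also need
    \<open>f\<close> to be \<open>undefined\<close> outside \<open>X\<close>; membership in the
    hom-set provides this.\<close>
  fix X Y f assume "f \<in> Hom (cat_of_sets \<U>) X Y"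
  then show "Cmp (cat_of_sets \<U>) X X Y f (Idn (cat_of_sets \<U>) X) = f"
    and "Cmp (cat_of_sets \<U>) X Y Y (Idn (cat_of_sets \<U>) Y) f = f"
    by (auto simp: compose_def fun_eq_iff PiE_def extensional_def)
qed (auto simp: compose_def fun_eq_iff)

text \<open>Both sides of a naturality square are composites restricted to \<open>FObj F X\<close>.
  Evaluating them at an element of that set removes the restriction and leaves a usable pointwise
  equation.\<close>

lemma is_nat_trans_setsD:
  assumes "is_nat_trans C (cat_of_sets \<U>) F G \<phi>" "X \<in> Obj C"
  shows nat_trans_sets_mem: "x \<in> FObj F X \<Longrightarrow> \<phi> X x \<in> FObj G X"
    and nat_trans_sets_natural: "Y \<in> Obj C \<Longrightarrow> f \<in> Hom C X Y \<Longrightarrow> x \<in> FObj F X \<Longrightarrow>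
           FArr G X Y f (\<phi> X x) = \<phi> Y (FArr F X Y f x)"
proof -
  show "\<phi> X x \<in> FObj G X" if "x \<in> FObj F X"
    using assms that by (auto simp: is_nat_trans_def)
  assume "Y \<in> Obj C" "f \<in> Hom C X Y" "x \<in> FObj F X"
  moreover from this have
    "compose (FObj F X) (FArr G X Y f) (\<phi> X) x = compose (FObj F X) (\<phi> Y) (FArr F X Y f) x"
    using assms by (simp add: is_nat_trans_def)
  ultimately show "FArr G X Y f (\<phi> X x) = \<phi> Y (FArr F X Y f x)"
    by (simp add: compose_eq)
qed

section \<open>The labelled finite powerset functor\<close>

lemma pow_map_in_PiE:
  assumes "f \<in> X \<rightarrow> Y"
  shows "pow_map X f \<in> pow_set X \<rightarrow>\<^sub>E pow_set Y"
  using assms by (fastforce simp: pow_map_def pow_set_def)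

text \<open>The target is the category of all subsets of \<open>'l \<Rightarrow> 'u set\<close>,
  since labelled powersets live in a different type and are not encoded in the universe.\<close>

lemma is_functor_pow_functor: "is_functor (cat_of_sets \<U>) (cat_of_sets UNIV) pow_functor"
proof (rule is_functorI)
  fix X Y :: "'a set" and f
  assume "f \<in> Hom (cat_of_sets \<U>) X Y"
  then have "f \<in> X \<rightarrow> Y" by auto
  then show "FArr pow_functor X Y f
      \<in> Hom (cat_of_sets UNIV) (FObj pow_functor X) (FObj pow_functor Y)"
    by (simp add: pow_functor_def pow_map_in_PiE)
next
  fix X :: "'a set"
  have "(\<lambda>x\<in>X. x) ` \<phi> \<mu> = \<phi> \<mu>" if "\<phi> \<in> pow_set X" for \<phi> :: "'b \<Rightarrow> 'a set" and \<mu>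
    using that by (force simp: pow_set_def)
  then show "FArr pow_functor X X (Idn (cat_of_sets \<U>) X)
      = Idn (cat_of_sets UNIV) (FObj pow_functor X :: ('b \<Rightarrow> 'a set) set)"
    by (auto simp: pow_functor_def pow_map_def fun_eq_iff)
next
  fix X Y Z :: "'a set" and f g
  assume f: "f \<in> Hom (cat_of_sets \<U>) X Y"
  have "pow_map X (compose X g f) \<phi> = compose (pow_set X) (pow_map Y g) (pow_map X f) \<phi>"
    for \<phi> :: "'b \<Rightarrow> 'a set"
  proof (cases "\<phi> \<in> pow_set X")
    case True
    \<comment> \<open>Since \<open>\<phi> \<mu>\<close> lies inside \<open>X\<close>, the restricted
      composite agrees there with plain composition. For \<open>\<phi>\<close> outside
      \<open>pow_set X\<close> both sides are \<open>undefined\<close>.\<close>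
    then have "compose X g f ` \<phi> \<mu> = g ` f ` \<phi> \<mu>" for \<mu>
      by (force simp: pow_set_def compose_def image_image)
    moreover have "pow_map X f \<phi> \<in> pow_set Y"
      using pow_map_in_PiE[of f X Y] f True by auto
    ultimately show ?thesis
      using True by (simp add: compose_eq pow_map_def)
  qed (simp add: pow_map_def compose_def)
  then show "FArr pow_functor X Z (Cmp (cat_of_sets \<U>) X Y Z g f) =
      Cmp (cat_of_sets UNIV) (FObj pow_functor X) (FObj pow_functor Y)
        (FObj pow_functor Z :: ('b \<Rightarrow> 'a set) set)
        (FArr pow_functor Y Z g) (FArr pow_functor X Y f)"
    by (simp add: pow_functor_def fun_eq_iff)
qed (simp_all add: is_category_cat_of_sets)

section \<open>Categories of coalgebras\<close>

lemma Coalg_simps [simp]: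
  "(X, c) \<in> Obj (Coalg V G) \<longleftrightarrow> X \<in> Sets V \<and> c \<in> X \<rightarrow>\<^sub>E FObj G X"
  "f \<in> Hom (Coalg V G) (X, c) (Y, d) \<longleftrightarrow>
     f \<in> X \<rightarrow>\<^sub>E Y \<and> (\<forall>x\<in>X. FArr G X Y f (c x) = d (f x))"
  "Idn (Coalg V G) (X, c) = (\<lambda>x\<in>X. x)"
  "Cmp (Coalg V G) (X, c) (Y, d) (Z, e) g f = compose X g f"
  by (auto simp: Coalg_def compose_def fun_eq_iff)

text \<open>Associativity and the unit laws are those of the underlying maps. Functoriality of
  \<open>G\<close> makes identities and composites homomorphisms. The codomain family
  \<open>\<U>\<close> is arbitrary, so that \<open>G\<close> may end in
  \<open>pow_functor\<close>.\<close>

lemma is_category_Coalg: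
  assumes G: "is_functor (Set_cat V) (cat_of_sets \<U>) G"
  shows "is_category (Coalg V G)"
proof -
  have cmp: "compose X g f \<in> Hom (Coalg V G) (X, c) (Z, e)"
    if Xc: "(X, c) \<in> Obj (Coalg V G)" and Yd: "(Y, d) \<in> Obj (Coalg V G)"
      and Ze: "(Z, e) \<in> Obj (Coalg V G)"
      and f: "f \<in> Hom (Coalg V G) (X, c) (Y, d)" and g: "g \<in> Hom (Coalg V G) (Y, d) (Z, e)"
    for X c Y d Z e f g
  proof -
    have "FArr G X Z (compose X g f) (c x) = e (compose X g f x)" if x: "x \<in> X" for x
    proof -
      have "FArr G X Z (compose X g f) = compose (FObj G X) (FArr G Y Z g) (FArr G X Y f)"
        using is_functor_comp[OF G, of X Y Z f g] Xc Yd Ze f g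
        by simp
      \<comment> \<open>The image of a composite under \<open>G\<close> is restricted to
        \<open>FObj G X\<close>, so this membership is what allows it to be split at
        \<open>c x\<close>. Next, \<open>f x \<in> Y\<close> lets the homomorphism equation of
        \<open>g\<close> apply.\<close>
      moreover have "c x \<in> FObj G X" using Xc x by auto
      moreover have "f x \<in> Y" using f x by auto
      ultimately show ?thesis using f g x by (simp add: compose_eq)
    qed
    then show ?thesis using f g compose_in_PiE[of f X Y g Z] by simp
  qed
  have id: "(\<lambda>x\<in>X. x) \<in> Hom (Coalg V G) (X, c) (X, c)" if "(X, c) \<in> Obj (Coalg V G)" for X c
  proof -
    have "FArr G X X (\<lambda>x\<in>X. x) = (\<lambda>y\<in>FObj G X. y)"
      using is_functor_id[OF G, of X] that by simp
    then show ?thesis using that by auto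
  qed
  show ?thesis
    unfolding is_category_def
  proof (intro conjI ballI, goal_cases)
    case (1 X) then show ?case using id by (cases X) simp
  next
    case (2 X Y Z f g)
    then show ?case
      by (cases X, cases Y, cases Z) (metis cmp Coalg_simps(4))
  next
    case (3 X Y f)
    then show ?case by (cases X, cases Y) (auto simp: compose_def fun_eq_iff PiE_def extensional_def)
  next
    case (4 X Y f)
    then show ?case by (cases X, cases Y) (auto simp: compose_def fun_eq_iff PiE_def extensional_def)
  next
    case (5 W X Y Z f g h)
    then show ?case
      by (cases W, cases X, cases Y, cases Z) (auto simp: compose_def fun_eq_iff)
  qed
qed

lemma is_category_Coalg_pow:
  assumes "is_functor (Set_cat V) (Set_cat V) F"
  shows "is_category (Coalg_pow V F)"
  by (rule is_category_Coalg[OF is_functor_comp_functor[OF assms is_functor_pow_functor]])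

section \<open>Products of sets and of maps via the encoded pairing\<close>

lemma pair_eq_iff [simp]:
  "is_universe V \<Longrightarrow> pair V p = pair V q \<longleftrightarrow> p = q"
  by (auto simp: is_universe_def dest: injD)

lemma pair_in_prod_set [simp]:
  "is_universe V \<Longrightarrow> pair V (x, y) \<in> prod_set V X Y \<longleftrightarrow> x \<in> X \<and> y \<in> Y"
  by (auto simp: prod_set_def)

lemma prod_setE:
  assumes "p \<in> prod_set V X Y"
  obtains x y where "p = pair V (x, y)" "x \<in> X" "y \<in> Y"
  using assms by (auto simp: prod_set_def)

lemma prod_map_pair [simp]:
  assumes "is_universe V" "x \<in> X" "y \<in> Y"
  shows "prod_map V X Y f g (pair V (x, y)) = pair V (f x, g y)"
  using assms by (simp add: prod_map_def inv_f_f is_universe_def)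

lemma prod_map_in_PiE:
  assumes "is_universe V" "f \<in> X \<rightarrow> X'" "g \<in> Y \<rightarrow> Y'"
  shows "prod_map V X Y f g \<in> prod_set V X Y \<rightarrow>\<^sub>E prod_set V X' Y'"
proof (rule PiE_I)
  fix p assume "p \<in> prod_set V X Y"
  then show "prod_map V X Y f g p \<in> prod_set V X' Y'"
    using assms by (auto elim!: prod_setE)
qed (simp add: prod_map_def)

lemma prod_map_id:
  assumes "is_universe V"
  shows "prod_map V X Y (\<lambda>x\<in>X. x) (\<lambda>y\<in>Y. y) = (\<lambda>p\<in>prod_set V X Y. p)"
proof
  fix p show "prod_map V X Y (\<lambda>x\<in>X. x) (\<lambda>y\<in>Y. y) p = (\<lambda>p\<in>prod_set V X Y. p) p"
    using assms by (cases "p \<in> prod_set V X Y") (auto elim!: prod_setE, simp add: prod_map_def)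
qed

text \<open>The typing of \<open>f\<close> and \<open>g\<close> keeps the intermediate pair inside
  \<open>prod_set V X' Y'\<close>, outside of which the second product map is
  \<open>undefined\<close>. Off \<open>prod_set V X Y\<close> both sides are
  \<open>undefined\<close>.\<close>

lemma prod_map_compose:
  assumes "is_universe V" "f \<in> X \<rightarrow> X'" "g \<in> Y \<rightarrow> Y'"
  shows "prod_map V X Y (compose X f' f) (compose Y g' g)
    = compose (prod_set V X Y) (prod_map V X' Y' f' g') (prod_map V X Y f g)"
proof
  fix p
  show "prod_map V X Y (compose X f' f) (compose Y g' g) p
    = compose (prod_set V X Y) (prod_map V X' Y' f' g') (prod_map V X Y f g) p"
  proof (cases "p \<in> prod_set V X Y")
    case True
    then obtain x y where "p = pair V (x, y)" "x \<in> X" "y \<in> Y" by (rule prod_setE)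
    moreover from this have "f x \<in> X'" "g y \<in> Y'" using assms by auto
    ultimately show ?thesis using assms by (simp add: compose_eq)
  qed (simp add: prod_map_def compose_def)
qed

section \<open>Synchronization along coalgebra homomorphisms\<close>

lemma pow_map_apply: "\<phi> \<in> pow_set X \<Longrightarrow> pow_map X f \<phi> = (\<lambda>\<mu>. f ` \<phi> \<mu>)"
  by (simp add: pow_map_def)

text \<open>The injection of a state into grade \<open>m\<close> is the unit followed by the
  extension from grade zero, which exists because zero plus \<open>m\<close> is \<open>m\<close>. It
  is natural as a composite of two natural transformations. It describes the component that stays
  idle in an interleaving step.\<close>

lemma gembed_natural:
  assumes P: "is_pcm P" and T: "is_graded_monad V P T" and E: "is_extensible V P T"
    and X: "X \<in> Sets V" and x: "x \<in> X"
  shows "gext T (pzero P) m X (gunit T X x) \<in> FObj (gfun T m) X"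
    and "Y \<in> Sets V \<Longrightarrow> f \<in> X \<rightarrow>\<^sub>E Y \<Longrightarrow>
      FArr (gfun T m) X Y f (gext T (pzero P) m X (gunit T X x))
        = gext T (pzero P) m Y (gunit T Y (f x))"
proof -
  have "prec P (pzero P) m" using P by (auto simp: prec_def is_pcm_def)
  then have ext: "is_nat_trans (Set_cat V) (Set_cat V) (gfun T (pzero P)) (gfun T m)
      (gext T (pzero P) m)"
    using E by (simp add: is_extensible_def)
  have unit: "is_nat_trans (Set_cat V) (Set_cat V) id_functor (gfun T (pzero P)) (gunit T)"
    using T by (simp add: is_graded_monad_def)
  have ux: "gunit T X x \<in> FObj (gfun T (pzero P)) X"
    using nat_trans_sets_mem[OF unit] X x by (simp add: id_functor_def)
  show "gext T (pzero P) m X (gunit T X x) \<in> FObj (gfun T m) X"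
    using nat_trans_sets_mem[OF ext] X ux by simp
  assume "Y \<in> Sets V" "f \<in> X \<rightarrow>\<^sub>E Y"
  then show "FArr (gfun T m) X Y f (gext T (pzero P) m X (gunit T X x))
      = gext T (pzero P) m Y (gunit T Y (f x))"
    using nat_trans_sets_natural[OF ext] nat_trans_sets_natural[OF unit] X x ux
    by (simp add: id_functor_def)
qed

lemma comp_pow_functor_simps [simp]:
  "FObj (comp_functor pow_functor F) X = pow_set (FObj F X)"
  "FArr (comp_functor pow_functor F) X Y f = pow_map (FObj F X) (FArr F X Y f)"
  by (simp_all add: comp_functor_def pow_functor_def)

text \<open>The homomorphism equation read at one label: the successors of \<open>f x\<close> are
  exactly the images of successors of \<open>x\<close>. The inclusion from left to right lifts
  transitions back along \<open>f\<close>, the converse preserves them.\<close>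

lemma Coalg_pow_hom_image:
  assumes "(X, c) \<in> Obj (Coalg_pow V F)" "f \<in> Hom (Coalg_pow V F) (X, c) (Y, d)" "x \<in> X"
  shows "d (f x) \<mu> = FArr F X Y f ` c x \<mu>"
proof -
  have "c x \<in> pow_set (FObj F X)" using assms by auto
  moreover have "pow_map (FObj F X) (FArr F X Y f) (c x) = d (f x)" using assms by simp
  ultimately show ?thesis by (metis pow_map_apply)
qed

text \<open>Both inclusions go by cases on the rule that derives a step, and each rule is matched
  with itself. The statement concerns bare successor sets, so finiteness does not enter.\<close>

lemma sync_step_hom:
  assumes V: "is_universe V" and P: "is_pcm P" and T: "is_graded_monad V P T"
    and E: "is_extensible V P T"
    and Xc: "(X, c) \<in> Obj (Coalg_pow V (gfun T m))" and Yd: "(Y, d) \<in> Obj (Coalg_pow V (gfun T n))"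
    and X': "X' \<in> Sets V" and Y': "Y' \<in> Sets V"
    and f: "f \<in> Hom (Coalg_pow V (gfun T m)) (X, c) (X', c')"
    and g: "g \<in> Hom (Coalg_pow V (gfun T n)) (Y, d) (Y', d')"
    and s: "s \<in> X" and t: "t \<in> Y"
  shows "{q. sync_step V P T A m n (X', c') (Y', d') (pair V (f s, g t)) \<mu> q}
    = prod_map V (FObj (gfun T m) X) (FObj (gfun T n) Y)
        (FArr (gfun T m) X X' f) (FArr (gfun T n) Y Y' g)
      ` {q. sync_step V P T A m n (X, c) (Y, d) (pair V (s, t)) \<mu> q}"
    (is "?S' = ?h ` ?S")
proof -
  let ?Tf = "FArr (gfun T m) X X' f" and ?Tg = "FArr (gfun T n) Y Y' g"
  have fs: "f s \<in> X'" and gt: "g t \<in> Y'" using f g s t by auto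
  have cf: "c' (f s) \<nu> = ?Tf ` c s \<nu>" for \<nu> by (rule Coalg_pow_hom_image[OF Xc f s])
  have dg: "d' (g t) \<nu> = ?Tg ` d t \<nu>" for \<nu> by (rule Coalg_pow_hom_image[OF Yd g t])
  have cs: "\<Delta> \<in> FObj (gfun T m) X" if "\<Delta> \<in> c s \<nu>" for \<Delta> \<nu>
    using Xc s that by (fastforce simp: pow_set_def)
  have dt: "\<Theta> \<in> FObj (gfun T n) Y" if "\<Theta> \<in> d t \<nu>" for \<Theta> \<nu>
    using Yd t that by (fastforce simp: pow_set_def)
  have XY: "X \<in> Sets V" "Y \<in> Sets V" and fg: "f \<in> X \<rightarrow>\<^sub>E X'" "g \<in> Y \<rightarrow>\<^sub>E Y'"
    using Xc Yd f g by auto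
  note es = gembed_natural(1)[OF P T E XY(1) s, of m]
    and et = gembed_natural(1)[OF P T E XY(2) t, of n]
    and fes = gembed_natural(2)[OF P T E XY(1) s X' fg(1), of m]
    and get = gembed_natural(2)[OF P T E XY(2) t Y' fg(2), of n]
  show ?thesis
  proof (intro equalityI subsetI)
    \<comment> \<open>Lifting: \<open>cf\<close> and \<open>dg\<close> supply preimages of the
      targets in the rule premises, and \<open>get\<close> or \<open>fes\<close> identifies the idle
      component as the image of the injected \<open>t\<close> or \<open>s\<close>.\<close>
    fix q' assume "q' \<in> ?S'"
    then have "sync_step V P T A m n (X', c') (Y', d') (pair V (f s, g t)) \<mu> q'" by simp
    then show "q' \<in> ?h ` ?S"
    proof cases
      case (left s' t' \<Delta>')
      then have st: "s' = f s" "t' = g t" using V by simp_all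
      with left cf obtain \<Delta> where D: "\<Delta> \<in> c s \<mu>" "\<Delta>' = ?Tf \<Delta>" by auto
      let ?q = "pair V (\<Delta>, gext T (pzero P) n Y (gunit T Y t))"
      have "?q \<in> ?S"
        using sync_step.left[of s "(X, c)" t "(Y, d)"] s t D by simp
      moreover have "q' = ?h ?q" using left st D V cs[OF D(1)] et get by simp
      ultimately show ?thesis by (rule rev_image_eqI)
    next
      case (right s' t' \<Theta>')
      then have st: "s' = f s" "t' = g t" using V by simp_all
      with right dg obtain \<Theta> where D: "\<Theta> \<in> d t \<mu>" "\<Theta>' = ?Tg \<Theta>" by auto
      let ?q = "pair V (gext T (pzero P) m X (gunit T X s), \<Theta>)"
      have "?q \<in> ?S"
        using sync_step.right[of s "(X, c)" t "(Y, d)"] s t D by simp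
      moreover have "q' = ?h ?q" using right st D V dt[OF D(1)] es fes by simp
      ultimately show ?thesis by (rule rev_image_eqI)
    next
      \<comment> \<open>Here \<open>\<mu>\<close> is \<open>tau A\<close>, while
        \<open>\<nu>\<close> is the label on which the components synchronize; the two preimages are
        taken at \<open>\<nu>\<close> and \<open>bar A \<nu>\<close>.\<close>
      case (comm s' t' \<nu> \<Delta>' \<Theta>')
      then have st: "s' = f s" "t' = g t" using V by simp_all
      with comm cf dg obtain \<Delta> \<Theta> where D: "\<Delta> \<in> c s \<nu>" "\<Delta>' = ?Tf \<Delta>"
        "\<Theta> \<in> d t (bar A \<nu>)" "\<Theta>' = ?Tg \<Theta>" by auto
      have "pair V (\<Delta>, \<Theta>) \<in> ?S"
        using sync_step.comm[of s "(X, c)" t "(Y, d)"] s t D comm by simp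
      moreover have "q' = ?h (pair V (\<Delta>, \<Theta>))"
        using comm st D V cs[OF D(1)] dt[OF D(3)] by simp
      ultimately show ?thesis by (rule rev_image_eqI)
    qed
  next
    fix q' assume "q' \<in> ?h ` ?S"
    then obtain q where q: "sync_step V P T A m n (X, c) (Y, d) (pair V (s, t)) \<mu> q"
      and q': "q' = ?h q" by auto
    \<comment> \<open>Preservation: the rule that derived \<open>q\<close> is applied again at
      \<open>(f s, g t)\<close>, with its premises pushed forward along \<open>cf\<close> and
      \<open>dg\<close>.\<close>
    from q have "sync_step V P T A m n (X', c') (Y', d') (pair V (f s, g t)) \<mu> (?h q)"
    proof cases
      case (left s' t' \<Delta>)
      then have D: "s' = s" "t' = t" "\<Delta> \<in> c s \<mu>" using V by simp_all
      then have "?Tf \<Delta> \<in> c' (f s) \<mu>" using cf by simp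
      then show ?thesis
        using sync_step.left[of "f s" "(X', c')" "g t" "(Y', d')" "?Tf \<Delta>"] left D
          V cs[OF D(3)] et get fs gt by simp
    next
      case (right s' t' \<Theta>)
      then have D: "s' = s" "t' = t" "\<Theta> \<in> d t \<mu>" using V by simp_all
      then have "?Tg \<Theta> \<in> d' (g t) \<mu>" using dg by simp
      then show ?thesis
        using sync_step.right[of "f s" "(X', c')" "g t" "(Y', d')" "?Tg \<Theta>"] right D
          V dt[OF D(3)] es fes fs gt by simp
    next
      case (comm s' t' \<nu> \<Delta> \<Theta>)
      then have D: "s' = s" "t' = t" "\<Delta> \<in> c s \<nu>" "\<Theta> \<in> d t (bar A \<nu>)" using V by simp_all
      then have "?Tf \<Delta> \<in> c' (f s) \<nu>" "?Tg \<Theta> \<in> d' (g t) (bar A \<nu>)"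
        using cf dg by simp_all
      then show ?thesis
        using sync_step.comm[of "f s" "(X', c')" "g t" "(Y', d')" \<nu> A "?Tf \<Delta>" "?Tg \<Theta>"] comm D
          V cs[OF D(3)] dt[OF D(4)] fs gt by simp
    qed
    then show "q' \<in> ?S'" using q' by simp
  qed
qed

section \<open>The parallel composition functor\<close>

theorem mainTheorem10:
  fixes V :: "'u universe" and P :: "'m pcm" and T :: "('m, 'u) graded"
    and A :: "'l labels" and m n :: 'm
    and \<alpha> :: "'u set \<times> 'u set \<Rightarrow> 'u \<Rightarrow> 'u"
  assumes "is_universe V"
    and "is_pcm P"
    and "is_graded_monad V P T"
    and "is_extensible V P T"
    and "is_labels A"
    and "orth P m n"
    and "is_nat_trans (prod_cat (Set_cat V) (Set_cat V)) (Set_cat V)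
           (comp_functor (times_functor V) (prod_functor (gfun T m) (gfun T n)))
           (comp_functor (gfun T (psum P m n)) (times_functor V)) \<alpha>"
    and "sync_well_defined V P T A m n"
  shows "\<exists>par. is_functor
           (prod_cat (Coalg_pow V (gfun T m)) (Coalg_pow V (gfun T n)))
           (Coalg_pow V (gfun T (psum P m n))) par \<and>
         (\<forall>(X, c) \<in> Obj (Coalg_pow V (gfun T m)). \<forall>(Y, d) \<in> Obj (Coalg_pow V (gfun T n)).
            FObj par ((X, c), (Y, d)) =
              (prod_set V X Y,
               compose (prod_set V X Y)
                 (pow_map (prod_set V (FObj (gfun T m) X) (FObj (gfun T n) Y)) (\<alpha> (X, Y)))
                 (sync V P T A m n (X, c) (Y, d) :: 'u \<Rightarrow> 'l \<Rightarrow> 'u set))) \<and>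
         (\<forall>(X, c) \<in> Obj (Coalg_pow V (gfun T m)). \<forall>(Y, d) \<in> Obj (Coalg_pow V (gfun T n)).
          \<forall>(X', c') \<in> Obj (Coalg_pow V (gfun T m)). \<forall>(Y', d') \<in> Obj (Coalg_pow V (gfun T n)).
          \<forall>f \<in> Hom (Coalg_pow V (gfun T m)) (X, c) (X', c').
          \<forall>g \<in> Hom (Coalg_pow V (gfun T n)) (Y, d) (Y', d').
            FArr par ((X, c), (Y, d)) ((X', c'), (Y', d')) (f, g) = prod_map V X Y f g)"
proof -
  note V = assms(1) and P = assms(2) and T = assms(3) and E = assms(4) and \<alpha> = assms(7)
    and sync = assms(8)
  let ?k = "psum P m n"
  \<comment> \<open>The type annotations fix the label type \<open>'l\<close>, which
    \<open>gfun T m\<close> does not determine.\<close>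
  let ?C = "Coalg_pow V (gfun T m)
      :: ('u set \<times> ('u \<Rightarrow> 'l \<Rightarrow> 'u set), 'u \<Rightarrow> 'u) cat"
  let ?D = "Coalg_pow V (gfun T n)
      :: ('u set \<times> ('u \<Rightarrow> 'l \<Rightarrow> 'u set), 'u \<Rightarrow> 'u) cat"
  let ?E = "Coalg_pow V (gfun T ?k)
      :: ('u set \<times> ('u \<Rightarrow> 'l \<Rightarrow> 'u set), 'u \<Rightarrow> 'u) cat"
  let ?TT = "\<lambda>X Y. prod_set V (FObj (gfun T m) X) (FObj (gfun T n) Y)"
  let ?st = "\<lambda>X c Y d. compose (prod_set V X Y) (pow_map (?TT X Y) (\<alpha> (X, Y)))
      (sync V P T A m n (X, c) (Y, d))"
  \<comment> \<open>The arrow part reads off only the carriers of the source object: they are the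
    domain to which the extensional product map is restricted.\<close>
  define par where "par =
    \<lparr>FObj = (\<lambda>((X, c), (Y, d)). (prod_set V X Y, ?st X c Y d)),
     FArr = (\<lambda>((X, c), (Y, d)) Z (f, g). prod_map V X Y f g)\<rparr>"
  have Obj_par: "FObj par ((X, c), (Y, d)) = (prod_set V X Y, ?st X c Y d)"
    and Arr_par: "FArr par ((X, c), (Y, d)) Z (f, g) = prod_map V X Y f g"
    for X c Y d Z f g by (simp_all add: par_def)
  have F: "is_functor (Set_cat V) (Set_cat V) (gfun T i)" for i
    using T by (simp add: is_graded_monad_def)
  have prod: "prod_set V X Y \<in> Sets V" if "X \<in> Sets V" "Y \<in> Sets V" for X Y
    using V that by (simp add: is_universe_def)
  have \<alpha>_mem: "\<alpha> (X, Y) \<in> ?TT X Y \<rightarrow> FObj (gfun T ?k) (prod_set V X Y)"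
    if "X \<in> Sets V" "Y \<in> Sets V" for X Y
    using nat_trans_sets_mem[OF \<alpha>, of "(X, Y)"] that
    by (auto simp: prod_cat_def comp_functor_def times_functor_def prod_functor_def)
  have \<alpha>_natural: "FArr (gfun T ?k) (prod_set V X Y) (prod_set V X' Y') (prod_map V X Y f g)
        (\<alpha> (X, Y) q)
      = \<alpha> (X', Y') (prod_map V (FObj (gfun T m) X) (FObj (gfun T n) Y)
          (FArr (gfun T m) X X' f) (FArr (gfun T n) Y Y' g) q)"
    if "X \<in> Sets V" "Y \<in> Sets V" "X' \<in> Sets V" "Y' \<in> Sets V"
      "f \<in> X \<rightarrow>\<^sub>E X'" "g \<in> Y \<rightarrow>\<^sub>E Y'" "q \<in> ?TT X Y" for X Y X' Y' f g q
    using nat_trans_sets_natural[OF \<alpha>, of "(X, Y)" "(X', Y')" "(f, g)" q] that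
    by (simp add: prod_cat_def comp_functor_def times_functor_def prod_functor_def)
  \<comment> \<open>Finiteness of the \<open>tau\<close>-successors, a union over all labels, enters
    here.\<close>
  have sync_mem: "sync V P T A m n (X, c) (Y, d) \<in> prod_set V X Y \<rightarrow>\<^sub>E pow_set (?TT X Y)"
    if "(X, c) \<in> Obj ?C" "(Y, d) \<in> Obj ?D" for X c Y d
    using sync that unfolding sync_well_defined_def by blast
  have obj: "(prod_set V X Y, ?st X c Y d) \<in> Obj ?E"
    if Xc: "(X, c) \<in> Obj ?C" and Yd: "(Y, d) \<in> Obj ?D" for X c Y d
  proof -
    have "pow_map (?TT X Y) (\<alpha> (X, Y))
        \<in> pow_set (?TT X Y) \<rightarrow>\<^sub>E pow_set (FObj (gfun T ?k) (prod_set V X Y))"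
      using Xc Yd by (intro pow_map_in_PiE \<alpha>_mem) simp_all
    then show ?thesis
      using prod compose_in_PiE[OF sync_mem[OF Xc Yd]] Xc Yd by simp
  qed
  have hom: "prod_map V X Y f g
      \<in> Hom ?E (prod_set V X Y, ?st X c Y d) (prod_set V X' Y', ?st X' c' Y' d')"
    if Xc: "(X, c) \<in> Obj ?C" and Yd: "(Y, d) \<in> Obj ?D"
      and Xc': "(X', c') \<in> Obj ?C" and Yd': "(Y', d') \<in> Obj ?D"
      and f: "f \<in> Hom ?C (X, c) (X', c')" and g: "g \<in> Hom ?D (Y, d) (Y', d')"
    for X c Y d X' c' Y' d' f g
  proof -
    have sets: "X \<in> Sets V" "Y \<in> Sets V" "X' \<in> Sets V" "Y' \<in> Sets V"
      and fg: "f \<in> X \<rightarrow>\<^sub>E X'" "g \<in> Y \<rightarrow>\<^sub>E Y'"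
      using Xc Yd Xc' Yd' f g by simp_all
    let ?h = "prod_map V X Y f g"
    let ?Th = "FArr (gfun T ?k) (prod_set V X Y) (prod_set V X' Y') ?h"
    let ?S = "sync V P T A m n (X, c) (Y, d)" and ?S' = "sync V P T A m n (X', c') (Y', d')"
    have h: "?h \<in> prod_set V X Y \<rightarrow>\<^sub>E prod_set V X' Y'"
      using fg by (intro prod_map_in_PiE V) (simp_all add: PiE_def)
    \<comment> \<open>The homomorphism square for \<open>?h\<close>, evaluated at a state. The
      membership facts for \<open>?S p\<close>, \<open>?S' (?h p)\<close> and the composite
      structure permit each restricted \<open>pow_map\<close> to be unfolded to a labelwise
      image.\<close>
    have "pow_map (FObj (gfun T ?k) (prod_set V X Y)) ?Th (?st X c Y d p) = ?st X' c' Y' d' (?h p)"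
      if p: "p \<in> prod_set V X Y" for p
    proof -
      obtain s t where st: "p = pair V (s, t)" "s \<in> X" "t \<in> Y" using p by (rule prod_setE)
      have hp: "?h p \<in> prod_set V X' Y'" using h p by (rule PiE_mem)
      have S: "?S p \<in> pow_set (?TT X Y)" by (rule PiE_mem[OF sync_mem[OF Xc Yd] p])
      have S': "?S' (?h p) \<in> pow_set (?TT X' Y')" by (rule PiE_mem[OF sync_mem[OF Xc' Yd'] hp])
      have st_p: "?st X c Y d p = (\<lambda>\<mu>. \<alpha> (X, Y) ` ?S p \<mu>)"
        using p S by (simp add: compose_eq pow_map_apply)
      have "?st X c Y d p \<in> pow_set (FObj (gfun T ?k) (prod_set V X Y))"
        using obj[OF Xc Yd] p by auto
      then have "pow_map (FObj (gfun T ?k) (prod_set V X Y)) ?Th (?st X c Y d p)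
          = (\<lambda>\<mu>. ?Th ` \<alpha> (X, Y) ` ?S p \<mu>)"
        by (simp add: pow_map_apply st_p)
      also have "\<dots> = (\<lambda>\<mu>. \<alpha> (X', Y') ` ?S' (?h p) \<mu>)"
      proof
        fix \<mu>
        \<comment> \<open>Naturality of \<open>\<alpha>\<close> is available only at elements of
          \<open>?TT X Y\<close>; it exchanges \<open>?Th\<close> after \<open>\<alpha>\<close> for
          \<open>\<alpha>\<close> after the product of the two lifted maps. Then
          \<open>sync_step_hom\<close> turns the inner image into the successors of
          \<open>?h p\<close>.\<close>
        have "?S p \<mu> \<subseteq> ?TT X Y" using S by (simp add: pow_set_def)
        then have "?Th ` \<alpha> (X, Y) ` ?S p \<mu>
            = \<alpha> (X', Y') ` prod_map V (FObj (gfun T m) X) (FObj (gfun T n) Y)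
                (FArr (gfun T m) X X' f) (FArr (gfun T n) Y Y' g) ` ?S p \<mu>"
          unfolding image_image using \<alpha>_natural[OF sets fg] by (intro image_cong) auto
        also have "prod_map V (FObj (gfun T m) X) (FObj (gfun T n) Y)
                (FArr (gfun T m) X X' f) (FArr (gfun T n) Y Y' g) ` ?S p \<mu> = ?S' (?h p) \<mu>"
          using sync_step_hom[OF V P T E Xc Yd sets(3,4) f g st(2,3), of A \<mu>] p hp st V
          by (simp add: sync_def)
        finally show "?Th ` \<alpha> (X, Y) ` ?S p \<mu> = \<alpha> (X', Y') ` ?S' (?h p) \<mu>" .
      qed
      also have "\<dots> = ?st X' c' Y' d' (?h p)"
        using hp S' by (simp add: compose_eq pow_map_apply)
      finally show ?thesis .
    qed
    then show ?thesis using h by simp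
  qed
  have "is_functor (prod_cat ?C ?D) ?E par"
  proof (rule is_functorI, goal_cases)
    case 1 show ?case by (intro is_category_prod_cat is_category_Coalg_pow F)
  next
    case 2 show ?case by (intro is_category_Coalg_pow F)
  next
    case (3 Z)
    then obtain X c Y d where "Z = ((X, c), (Y, d))" by (metis surj_pair)
    with 3 obj[of X c Y d] show ?case by (simp add: Obj_par prod_cat_def)
  next
    case (4 Z Z' h)
    moreover obtain X c Y d X' c' Y' d' f g where
      "Z = ((X, c), (Y, d))" "Z' = ((X', c'), (Y', d'))" "h = (f, g)" by (metis surj_pair)
    ultimately show ?case
      using hom[of X c Y d X' c' Y' d' f g] by (simp add: Obj_par Arr_par prod_cat_def)
  next
    case (5 Z)
    obtain X c Y d where "Z = ((X, c), (Y, d))" by (metis surj_pair)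
    then show ?case by (simp add: Obj_par Arr_par prod_cat_def prod_map_id V)
  next
    case (6 Z Z' Z'' h h')
    moreover obtain X c Y d X' c' Y' d' X'' c'' Y'' d'' f g f' g' where
      "Z = ((X, c), (Y, d))" "Z' = ((X', c'), (Y', d'))" "Z'' = ((X'', c''), (Y'', d''))"
      "h = (f, g)" "h' = (f', g')" by (metis surj_pair)
    \<comment> \<open>Composition in all the coalgebra categories is that of the underlying maps, so
      only the law for product maps remains.\<close>
    ultimately show ?case
      using prod_map_compose[OF V, of f X X' g Y Y' f' g']
      by (simp add: Obj_par Arr_par prod_cat_def PiE_def)
  qed
  then show ?thesis
    by (intro exI[of _ par] conjI) (simp_all add: Obj_par Arr_par split_beta)
qed

end
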